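(* Let $G=(V,E)$ be a connected amply regular graph with parameters $(n,d,\alpha,\beta)$ (with $n=\infty$ allowed), neither complete nor empty, such that $1\ne\beta\ge\alpha$. Then the Lin--Lu--Yau curvature $\kappa_{LLY}(x,y)$ of any edge $xy\in E$ satisfies $$\kappa_{LLY}(x,y)\ge\frac{2+\left\lceil\frac{\alpha(\beta-\alpha)}{\beta-1}\right\rceil}{d}.$$
   Context: All graphs are simple and undirected. An amply regular graph with parameters $(n,d,\alpha,\beta)$ is a $d$-regular graph ($d$ finite) with $n$ vertices, $n=\infty$ being allowed, such that any two adjacent vertices have exactly $\alpha$ common neighbors and any two vertices at distance $2$ have exactly $\beta$ common neighbors. Lin--Lu--Yau curvature: for a locally finite graph $G=(V,E)$ with combinatorial distance $d(\cdot,\cdot)$ and vertex degrees $d_x$, and for $p\in[0,1]$, let $\mu_x^p$ be the probability measure on $V$ with $\mu_x^p(x)=p$, $\mu_x^p(y)=\frac{1-p}{d_x}$ if $xy\in E$, and $\mu_x^p(y)=0$ otherwise. The Wasserstein distance between probability measures $\mu_1,\mu_2$ on $V$ is $W_1(\mu_1,\mu_2)=\inf_\pi\sum_{y\in V}\sum_{x\in V}d(x,y)\pi(x,y)$, the infimum being over all $\pi:V\times V\to[0,1]$ with $\sum_{y}\pi(x,y)=\mu_1(x)$ and $\sum_x\pi(x,y)=\mu_2(y)$. For distinct vertices $x,y$ set $\kappa_p(x,y)=1-\frac{W_1(\mu_x^p,\mu_y^p)}{d(x,y)}$ and $\kappa_{LLY}(x,y)=\lim_{p\to1}\frac{\kappa_p(x,y)}{1-p}$.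 *)

theory Defs
  imports "HOL-Analysis.Analysis"
begin

text \<open>
  A graph is given by a vertex set \<open>V\<close> and an adjacency relation \<open>E\<close>, in which each
  undirected edge \<open>xy\<close> occurs as both \<open>(x, y)\<close> and \<open>(y, x)\<close>. The neighbourhood of \<open>x\<close>
  is \<open>E `` {x}\<close>, and \<open>E ^^ k\<close> relates the endpoints of walks of length \<open>k\<close>.
\<close>

definition simple_graph :: "'a set \<Rightarrow> 'a rel \<Rightarrow> bool" where
  "simple_graph V E \<longleftrightarrow> E \<subseteq> V \<times> V \<and> sym E \<and> irrefl E"

definition connected_graph :: "'a set \<Rightarrow> 'a rel \<Rightarrow> bool" where
  "connected_graph V E \<longleftrightarrow> (\<forall>x\<in>V. \<forall>y\<in>V. (x, y) \<in> E\<^sup>*)"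

definition complete_graph :: "'a set \<Rightarrow> 'a rel \<Rightarrow> bool" where
  "complete_graph V E \<longleftrightarrow> (\<forall>x\<in>V. \<forall>y\<in>V. x \<noteq> y \<longrightarrow> (x, y) \<in> E)"

definition empty_graph :: "'a rel \<Rightarrow> bool" where
  "empty_graph E \<longleftrightarrow> E = {}"

definition graph_order :: "'a set \<Rightarrow> enat" where
  "graph_order V = (if finite V then enat (card V) else \<infinity>)"

definition graph_dist :: "'a rel \<Rightarrow> 'a \<Rightarrow> 'a \<Rightarrow> enat" where
  "graph_dist E x y = Inf {enat k |k. (x, y) \<in> E ^^ k}"

definition amply_regular ::
    "'a set \<Rightarrow> 'a rel \<Rightarrow> enat \<Rightarrow> nat \<Rightarrow> nat \<Rightarrow> nat \<Rightarrow> bool" where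
  "amply_regular V E n d \<alpha> \<beta> \<longleftrightarrow>
     simple_graph V E \<and>
     graph_order V = n \<and>
     (\<forall>x\<in>V. finite (E `` {x}) \<and> card (E `` {x}) = d) \<and>
     (\<forall>x\<in>V. \<forall>y\<in>V. (x, y) \<in> E \<longrightarrow> card (E `` {x} \<inter> E `` {y}) = \<alpha>) \<and>
     (\<forall>x\<in>V. \<forall>y\<in>V. graph_dist E x y = 2 \<longrightarrow> card (E `` {x} \<inter> E `` {y}) = \<beta>)"

definition lazy_walk_measure :: "'a rel \<Rightarrow> real \<Rightarrow> 'a \<Rightarrow> 'a \<Rightarrow> real" where
  "lazy_walk_measure E p x y =
     (if y = x then p
      else if (x, y) \<in> E then (1 - p) / real (card (E `` {x}))
      else 0)"

definition transport_plan ::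
    "'a set \<Rightarrow> ('a \<Rightarrow> real) \<Rightarrow> ('a \<Rightarrow> real) \<Rightarrow> ('a \<Rightarrow> 'a \<Rightarrow> real) \<Rightarrow> bool" where
  "transport_plan V \<mu>1 \<mu>2 \<pi> \<longleftrightarrow>
     (\<forall>x\<in>V. \<forall>y\<in>V. \<pi> x y \<in> {0..1}) \<and>
     (\<forall>x\<in>V. ((\<lambda>y. \<pi> x y) has_sum \<mu>1 x) V) \<and>
     (\<forall>y\<in>V. ((\<lambda>x. \<pi> x y) has_sum \<mu>2 y) V)"

text \<open>
  The cost is taken in \<^typ>\<open>ennreal\<close>, where every sum exists: a divergent real sum
  would count as \<open>0\<close> and corrupt the infimum.
\<close>

definition transport_cost :: "'a set \<Rightarrow> 'a rel \<Rightarrow> ('a \<Rightarrow> 'a \<Rightarrow> real) \<Rightarrow> ennreal" where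
  "transport_cost V E \<pi> =
     (\<Sum>\<^sub>\<infinity>y\<in>V. \<Sum>\<^sub>\<infinity>x\<in>V. ennreal_of_enat (graph_dist E x y) * ennreal (\<pi> x y))"

definition wasserstein1 ::
    "'a set \<Rightarrow> 'a rel \<Rightarrow> ('a \<Rightarrow> real) \<Rightarrow> ('a \<Rightarrow> real) \<Rightarrow> ennreal" where
  "wasserstein1 V E \<mu>1 \<mu>2 = (INF \<pi>\<in>{\<pi>. transport_plan V \<mu>1 \<mu>2 \<pi>}. transport_cost V E \<pi>)"

text \<open>
  The conversions \<^const>\<open>enn2real\<close> and \<^const>\<open>the_enat\<close> lose nothing for vertices
  \<open>x\<close>, \<open>y\<close> of a connected locally finite graph, where both quantities are finite.
\<close>

definition p_curvature :: "'a set \<Rightarrow> 'a rel \<Rightarrow> real \<Rightarrow> 'a \<Rightarrow> 'a \<Rightarrow> real" where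
  "p_curvature V E p x y =
     1 - enn2real (wasserstein1 V E (lazy_walk_measure E p x) (lazy_walk_measure E p y))
           / real (the_enat (graph_dist E x y))"

definition LLY_curvature :: "'a set \<Rightarrow> 'a rel \<Rightarrow> 'a \<Rightarrow> 'a \<Rightarrow> real" where
  "LLY_curvature V E x y = Lim (at_left 1) (\<lambda>p. p_curvature V E p x y / (1 - p))"

end

theory Submission
  imports Defs
begin

text \<open>
  Let \<open>A\<close> and \<open>B\<close> be the neighbourhoods of \<open>x\<close> and \<open>y\<close> without \<open>y\<close> and \<open>x\<close>. The edges
  between \<open>A\<close> and \<open>B\<close>, together with \<open>\<beta> - \<alpha>\<close> loops at each of the \<open>\<alpha>\<close> common neighbours,
  form a \<open>(\<beta> - 1)\<close>-regular bipartite multigraph. By Hall's theorem it splits into \<open>\<beta> - 1\<close>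
  perfect matchings, one of which contains at least the average number
  \<open>\<alpha> (\<beta> - \<alpha>) / (\<beta> - 1)\<close> of loops; integrality produces the ceiling. At idleness
  \<open>p = 1 / (d + 1)\<close> the two measures are uniform on the closed unit balls, so this matching is
  a transport plan, in which every loop has cost 0 and every other matched edge has cost 1.
  The resulting bound on \<open>\<kappa>\<^sub>p / (1 - p)\<close> passes to the limit, since this quotient is
  nondecreasing in \<open>p\<close>.
\<close>

section \<open>Hall's marriage theorem\<close>

text \<open>Induction on \<open>A\<close> by tightness. If a nonempty proper subset \<open>S\<close>
  has exactly as many neighbours as elements, \<open>S\<close> is matched first and the rest avoids
  the neighbours of \<open>S\<close>. Otherwise every nonempty proper subset has a neighbour to
  spare, so an arbitrary pair can be matched and removed.\<close>

lemma hall_marriage: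
  fixes N :: "'a \<Rightarrow> 'b set"
  assumes "finite A" and "\<And>a. a \<in> A \<Longrightarrow> finite (N a)"
    and "\<And>S. S \<subseteq> A \<Longrightarrow> card S \<le> card (\<Union>(N ` S))"
  shows "\<exists>f. inj_on f A \<and> (\<forall>a\<in>A. f a \<in> N a)"
  using assms
proof (induction A arbitrary: N rule: finite_psubset_induct)
  case (psubset A)
  note fin = psubset.prems(1) and hall = psubset.prems(2)
  have finU: "finite (\<Union>(N ` S))" if "S \<subseteq> A" for S
    using that fin finite_subset[OF that psubset.hyps(1)] by auto
  consider "A = {}"
    | (tight) S where "S \<subset> A" "S \<noteq> {}" "card S = card (\<Union>(N ` S))"
    | (slack) "A \<noteq> {}" "\<And>S. S \<subset> A \<Longrightarrow> S \<noteq> {} \<Longrightarrow> card S < card (\<Union>(N ` S))"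
    using hall by (metis le_neq_implies_less psubset_imp_subset)
  then show ?case
  proof cases
    case 1
    then show ?thesis by simp
  next
    case tight
    define M where "M = \<Union>(N ` S)"
    have finS: "finite S" using tight(1) psubset.hyps(1) finite_subset by blast
    have "\<exists>f. inj_on f S \<and> (\<forall>a\<in>S. f a \<in> N a)"
      by (rule psubset.IH[OF tight(1)]) (use tight(1) fin hall in auto)
    then obtain f where f: "inj_on f S" "\<forall>a\<in>S. f a \<in> N a" by blast
    have "\<exists>g. inj_on g (A - S) \<and> (\<forall>a\<in>A - S. g a \<in> N a - M)"
    proof (rule psubset.IH)
      show "A - S \<subset> A" using tight(1,2) by blast
      show "finite (N a - M)" if "a \<in> A - S" for a using that fin by auto
      show "card T \<le> card (\<Union>((\<lambda>a. N a - M) ` T))" if T: "T \<subseteq> A - S" for T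
      proof -
        have finT: "finite T" using T psubset.hyps(1) by (meson finite_Diff finite_subset)
        \<comment> \<open>Hall's condition outside \<open>M\<close> is that of
          \<open>S \<union> T\<close> after cancelling \<open>card S = card M\<close>.\<close>
        have "card S + card T = card (S \<union> T)"
          using T finS finT by (subst card_Un_disjoint) auto
        also have "\<dots> \<le> card (\<Union>(N ` (S \<union> T)))"
          by (rule hall) (use T tight(1) in auto)
        also have "\<Union>(N ` (S \<union> T)) = M \<union> \<Union>((\<lambda>a. N a - M) ` T)"
          unfolding M_def by auto
        also have "card \<dots> \<le> card M + card (\<Union>((\<lambda>a. N a - M) ` T))"
          by (rule card_Un_le)
        finally show ?thesis using tight(3) by (simp add: M_def)
      qed
    qed
    then obtain g where g: "inj_on g (A - S)" "\<forall>a\<in>A - S. g a \<in> N a - M" by blast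
    have "inj_on (\<lambda>a. if a \<in> S then f a else g a) A"
    proof (rule inj_onI)
      fix u v assume uv: "u \<in> A" "v \<in> A"
        "(if u \<in> S then f u else g u) = (if v \<in> S then f v else g v)"
      have fM: "f w \<in> M" if "w \<in> S" for w using f(2) that by (auto simp: M_def)
      have gM: "g w \<notin> M" if "w \<in> A - S" for w using g(2) that by blast
      show "u = v"
        using uv fM[of u] fM[of v] gM[of u] gM[of v] inj_onD[OF f(1), of u v] inj_onD[OF g(1), of u v]
        by (cases "u \<in> S"; cases "v \<in> S") auto
    qed
    then show ?thesis using f g
      by (intro exI[of _ "\<lambda>a. if a \<in> S then f a else g a"]) auto
  next
    case slack
    then obtain a where a: "a \<in> A" by blast
    have "card {a} \<le> card (\<Union>(N ` {a}))" by (rule hall) (use a in auto)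
    then obtain b where b: "b \<in> N a"
      by (metis UN_insert UN_empty Un_empty_right all_not_in_conv card.empty card_insert_disjoint
          empty_iff finite.emptyI not_less_eq_eq le0)
    have "\<exists>g. inj_on g (A - {a}) \<and> (\<forall>c\<in>A - {a}. g c \<in> N c - {b})"
    proof (rule psubset.IH)
      show "A - {a} \<subset> A" using a by blast
      show "finite (N c - {b})" if "c \<in> A - {a}" for c using that fin by auto
      show "card T \<le> card (\<Union>((\<lambda>c. N c - {b}) ` T))" if T: "T \<subseteq> A - {a}" for T
      proof (cases "T = {}")
        case False
        \<comment> \<open>Strictness pays for the deletion of the single element
          \<open>b\<close>.\<close>
        have "card T < card (\<Union>(N ` T))"
          by (rule slack(2)) (use T a False in auto)
        moreover have "\<Union>((\<lambda>c. N c - {b}) ` T) = \<Union>(N ` T) - {b}" by auto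
        moreover have "finite (\<Union>(N ` T))" by (rule finU) (use T in auto)
        ultimately show ?thesis by (auto simp: card_Diff_singleton_if)
      qed simp
    qed
    then obtain g where g: "inj_on g (A - {a})" "\<forall>c\<in>A - {a}. g c \<in> N c - {b}" by blast
    have "inj_on (g(a := b)) A"
      using g unfolding inj_on_def by auto
    moreover have "\<forall>c\<in>A. (g(a := b)) c \<in> N c" using g(2) b by simp
    ultimately show ?thesis by blast
  qed
qed

section \<open>Regular bipartite multigraphs, as matrices of edge multiplicities\<close>

lemma regular_matrix_card_eq:
  fixes m :: "'a \<Rightarrow> 'b \<Rightarrow> nat"
  assumes "k > 0"
    and row: "\<And>a. a \<in> A \<Longrightarrow> (\<Sum>b\<in>B. m a b) = k"
    and col: "\<And>b. b \<in> B \<Longrightarrow> (\<Sum>a\<in>A. m a b) = k"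
  shows "card A = card B"
proof -
  have "card A * k = (\<Sum>a\<in>A. \<Sum>b\<in>B. m a b)" by (simp add: row)
  also have "\<dots> = (\<Sum>b\<in>B. \<Sum>a\<in>A. m a b)" by (rule sum.swap)
  also have "\<dots> = card B * k" by (simp add: col)
  finally show ?thesis using assms(1) by simp
qed

lemma regular_matrix_perfect_matching:
  fixes m :: "'a \<Rightarrow> 'b \<Rightarrow> nat"
  assumes "finite A" "finite B" "k > 0"
    and row: "\<And>a. a \<in> A \<Longrightarrow> (\<Sum>b\<in>B. m a b) = k"
    and col: "\<And>b. b \<in> B \<Longrightarrow> (\<Sum>a\<in>A. m a b) = k"
  shows "\<exists>\<sigma>. bij_betw \<sigma> A B \<and> (\<forall>a\<in>A. m a (\<sigma> a) > 0)"
proof -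
  define N where "N a = {b \<in> B. m a b > 0}" for a
  have "\<exists>\<sigma>. inj_on \<sigma> A \<and> (\<forall>a\<in>A. \<sigma> a \<in> N a)"
  proof (rule hall_marriage[OF assms(1)])
    show "finite (N a)" for a using assms(2) by (simp add: N_def)
    show "card S \<le> card (\<Union>(N ` S))" if S: "S \<subseteq> A" for S
    proof -
      let ?M = "\<Union>(N ` S)"
      have MB: "?M \<subseteq> B" by (auto simp: N_def)
      have "card S * k = (\<Sum>a\<in>S. \<Sum>b\<in>B. m a b)" using S row by (simp add: subset_iff)
      also have "\<dots> = (\<Sum>a\<in>S. \<Sum>b\<in>?M. m a b)"
        by (intro sum.cong refl sum.mono_neutral_right assms(2) MB) (auto simp: N_def)
      also have "\<dots> = (\<Sum>b\<in>?M. \<Sum>a\<in>S. m a b)" by (rule sum.swap)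
      also have "\<dots> \<le> (\<Sum>b\<in>?M. \<Sum>a\<in>A. m a b)"
        by (intro sum_mono sum_mono2 assms(1) S) auto
      also have "\<dots> = card ?M * k" using MB col by (simp add: subset_iff)
      finally show ?thesis using assms(3) by simp
    qed
  qed
  then obtain \<sigma> where \<sigma>: "inj_on \<sigma> A" "\<forall>a\<in>A. \<sigma> a \<in> N a" by blast
  have "\<sigma> ` A = B"
    by (rule card_subset_eq[OF assms(2)])
      (use \<sigma> regular_matrix_card_eq[OF assms(3) row col] in \<open>auto simp: N_def card_image\<close>)
  then show ?thesis using \<sigma> by (auto simp: bij_betw_def N_def)
qed

text \<open>
  Peeling off one perfect matching at a time; a lower bound for all bijections rather than an
  existential claim keeps the induction hypothesis independent of the matrix.
\<close>

lemma regular_matrix_cost_ge: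
  fixes m :: "'a \<Rightarrow> 'b \<Rightarrow> nat" and c :: "'a \<Rightarrow> 'b \<Rightarrow> nat"
  assumes "finite A" "finite B"
    and "\<And>a. a \<in> A \<Longrightarrow> (\<Sum>b\<in>B. m a b) = k"
    and "\<And>b. b \<in> B \<Longrightarrow> (\<Sum>a\<in>A. m a b) = k"
    and min: "\<And>\<sigma>. bij_betw \<sigma> A B \<Longrightarrow> C \<le> (\<Sum>a\<in>A. c a (\<sigma> a))"
  shows "k * C \<le> (\<Sum>a\<in>A. \<Sum>b\<in>B. m a b * c a b)"
  using assms(3,4)
proof (induction k arbitrary: m)
  case (Suc k)
  obtain \<sigma> where \<sigma>: "bij_betw \<sigma> A B" "\<forall>a\<in>A. m a (\<sigma> a) > 0"
    using regular_matrix_perfect_matching[OF assms(1,2) _ Suc.prems] by blast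
  \<comment> \<open>The permutation matrix of \<sigma>. It lies below \<open>m\<close> entrywise, so
    the truncated subtraction \<open>m a b - e a b\<close> is exact and lowers every line sum by
    one.\<close>
  define e :: "'a \<Rightarrow> 'b \<Rightarrow> nat" where "e a b = (if b = \<sigma> a then 1 else 0)" for a b
  have e_le: "e a b \<le> m a b" if "a \<in> A" for a b
    using \<sigma>(2) that by (auto simp: e_def Suc_le_eq)
  have e_row: "(\<Sum>b\<in>B. e a b * f b) = f (\<sigma> a)" if "a \<in> A" for a and f :: "'b \<Rightarrow> nat"
    using that bij_betwE[OF \<sigma>(1)] assms(2) by (simp add: e_def if_distrib[of "\<lambda>x. x * _"] cong: if_cong)
  have e_col: "(\<Sum>a\<in>A. e a b) = 1" if b: "b \<in> B" for b
  proof -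
    obtain a where a: "a \<in> A" "b = \<sigma> a" using \<sigma>(1) b by (auto simp: bij_betw_def)
    have "(\<Sum>a'\<in>A. e a' b) = (\<Sum>a'\<in>A. if a' = a then 1 else 0)"
      using \<sigma>(1) a by (intro sum.cong) (auto simp: e_def bij_betw_def inj_on_def)
    then show ?thesis using a assms(1) by simp
  qed
  have "k * C \<le> (\<Sum>a\<in>A. \<Sum>b\<in>B. (m a b - e a b) * c a b)"
  proof (rule Suc.IH)
    show "(\<Sum>b\<in>B. m a b - e a b) = k" if "a \<in> A" for a
      using that Suc.prems(1)[OF that] e_le[OF that] e_row[OF that, of "\<lambda>_. 1"]
      by (simp add: sum_subtractf_nat)
    show "(\<Sum>a\<in>A. m a b - e a b) = k" if "b \<in> B" for b
      using that Suc.prems(2)[OF that] e_le e_col[OF that]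
      by (simp add: sum_subtractf_nat)
  qed
  moreover have "C \<le> (\<Sum>a\<in>A. \<Sum>b\<in>B. e a b * c a b)"
    using min[OF \<sigma>(1)] by (simp add: e_row)
  ultimately have "Suc k * C \<le> (\<Sum>a\<in>A. \<Sum>b\<in>B. (m a b - e a b) * c a b + e a b * c a b)"
    by (simp add: sum.distrib)
  also have "\<dots> = (\<Sum>a\<in>A. \<Sum>b\<in>B. m a b * c a b)"
    by (intro sum.cong refl) (simp add: e_le flip: add_mult_distrib)
  finally show ?case .
qed simp

text \<open>The minimum is at most the average: costs are natural numbers, so a cheapest bijection
  exists, and its cost serves as \<open>C\<close> in \<open>regular_matrix_cost_ge\<close>.\<close>

lemma regular_matrix_cheap_bijection:
  fixes m :: "'a \<Rightarrow> 'b \<Rightarrow> nat" and c :: "'a \<Rightarrow> 'b \<Rightarrow> nat"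
  assumes "finite A" "finite B" "k > 0"
    and "\<And>a. a \<in> A \<Longrightarrow> (\<Sum>b\<in>B. m a b) = k"
    and "\<And>b. b \<in> B \<Longrightarrow> (\<Sum>a\<in>A. m a b) = k"
  shows "\<exists>\<sigma>. bij_betw \<sigma> A B \<and> k * (\<Sum>a\<in>A. c a (\<sigma> a)) \<le> (\<Sum>a\<in>A. \<Sum>b\<in>B. m a b * c a b)"
proof -
  obtain \<sigma>0 where "bij_betw \<sigma>0 A B"
    using regular_matrix_perfect_matching[OF assms] by blast
  then obtain \<sigma> where "bij_betw \<sigma> A B"
      "\<And>\<tau>. bij_betw \<tau> A B \<Longrightarrow> (\<Sum>a\<in>A. c a (\<sigma> a)) \<le> (\<Sum>a\<in>A. c a (\<tau> a))"
    using ex_has_least_nat[of "\<lambda>\<sigma>. bij_betw \<sigma> A B" \<sigma>0 "\<lambda>\<sigma>. \<Sum>a\<in>A. c a (\<sigma> a)"] by blast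
  then show ?thesis
    using regular_matrix_cost_ge[OF assms(1,2,4,5)] by blast
qed

section \<open>Graph distance\<close>

lemma graph_dist_le: "(u, v) \<in> E ^^ k \<Longrightarrow> graph_dist E u v \<le> enat k"
  unfolding graph_dist_def by (rule Inf_lower) blast

lemma graph_dist_attained:
  assumes "(u, v) \<in> E\<^sup>*"
  obtains k where "graph_dist E u v = enat k" "(u, v) \<in> E ^^ k"
proof -
  obtain j where "(u, v) \<in> E ^^ j" using assms rtrancl_imp_relpow by blast
  then have "graph_dist E u v \<in> {enat k |k. (u, v) \<in> E ^^ k}"
    unfolding graph_dist_def by (intro wellorder_InfI[of "enat j"]) blast
  then show thesis using that by blast
qed

lemma graph_dist_self [simp]: "graph_dist E u u = 0"
  using graph_dist_le[of u u 0 E] by (simp flip: zero_enat_def)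

lemma graph_dist_ge_1:
  assumes "u \<noteq> v" shows "graph_dist E u v \<ge> 1"
  unfolding graph_dist_def
proof (rule Inf_greatest)
  fix z assume "z \<in> {enat k |k. (u, v) \<in> E ^^ k}"
  then obtain k where k: "z = enat k" "(u, v) \<in> E ^^ k" by blast
  then show "1 \<le> z" using assms by (cases k) (auto simp: one_enat_def)
qed

lemma graph_dist_adjacent:
  assumes "(u, v) \<in> E" "u \<noteq> v" shows "graph_dist E u v = 1"
  using graph_dist_le[of u v 1 E] graph_dist_ge_1[OF assms(2), of E] assms(1)
  by (simp add: one_enat_def)

lemma graph_dist_common_neighbour:
  assumes "(u, w) \<in> E" "(w, v) \<in> E" "u \<noteq> v" "(u, v) \<notin> E"
  shows "graph_dist E u v = 2"
proof -
  have uv: "(u, v) \<in> E ^^ 2" using assms by (auto simp: numeral_2_eq_2)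
  then obtain k where k: "graph_dist E u v = enat k" "(u, v) \<in> E ^^ k"
    using graph_dist_attained relpow_imp_rtrancl by metis
  have "k \<le> 2" using graph_dist_le[OF uv] k(1) by simp
  moreover have "k \<noteq> 0" "k \<noteq> 1" using k(2) assms(3,4) by (auto intro: gr0I)
  ultimately have "k = 2" by linarith
  then show ?thesis using k(1) by (simp add: numeral_eq_enat)
qed

lemma graph_dist_finite:
  assumes "connected_graph V E" "u \<in> V" "v \<in> V"
  shows "graph_dist E u v = enat (the_enat (graph_dist E u v))"
  using graph_dist_attained[of u v E] assms by (metis connected_graph_def the_enat.simps)

section \<open>Sums over a possibly infinite vertex set\<close>

lemma infsum_cmult_right_ennreal:
  fixes f :: "'b \<Rightarrow> ennreal"
  shows "(\<Sum>\<^sub>\<infinity>i\<in>I. c * f i) = c * (\<Sum>\<^sub>\<infinity>i\<in>I. f i)"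
  by (simp add: nonneg_infsum_complete SUP_mult_left_ennreal sum_distrib_left)

lemma infsum_add_ennreal:
  fixes f g :: "'b \<Rightarrow> ennreal"
  shows "(\<Sum>\<^sub>\<infinity>i\<in>I. f i + g i) = (\<Sum>\<^sub>\<infinity>i\<in>I. f i) + (\<Sum>\<^sub>\<infinity>i\<in>I. g i)"
  by (intro infsum_add nonneg_summable_on_complete) auto

lemma infsum_ge_single_ennreal:
  fixes f :: "'b \<Rightarrow> ennreal"
  assumes "i \<in> I"
  shows "f i \<le> (\<Sum>\<^sub>\<infinity>i\<in>I. f i)"
  using infsum_mono_neutral[of f "{i}" f I] assms by (simp add: nonneg_summable_on_complete)

lemma infsum_finite_support:
  fixes f :: "'b \<Rightarrow> 'c :: {comm_monoid_add,t2_space}"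
  assumes "finite S" "S \<subseteq> I" "\<And>i. i \<in> I - S \<Longrightarrow> f i = 0"
  shows "(\<Sum>\<^sub>\<infinity>i\<in>I. f i) = (\<Sum>i\<in>S. f i)"
  using assms infsum_cong_neutral[of S I f f] by (metis Diff_eq_empty_iff empty_iff infsum_finite)

lemma has_sum_finite_support:
  fixes f :: "'b \<Rightarrow> 'c :: {comm_monoid_add,topological_space}"
  assumes "finite S" "S \<subseteq> I" "\<And>i. i \<in> I - S \<Longrightarrow> f i = 0"
  shows "(f has_sum (\<Sum>i\<in>S. f i)) I"
  using has_sum_finite[OF assms(1), of f] assms has_sum_cong_neutral[of S I f f] by blast

lemma has_sum_indicator:
  fixes c :: real
  assumes "i \<in> I"
  shows "((\<lambda>j. if j = i then c else 0) has_sum c) I"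
  using has_sum_finite_support[of "{i}" I "\<lambda>j. if j = i then c else 0"] assms by simp

text \<open>Links the real marginal sums of a transport plan to the extended sums of its cost: for
  nonnegative terms both are the supremum of the finite partial sums.\<close>

lemma infsum_ennreal_has_sum:
  assumes "(f has_sum s) I" and "\<And>i. i \<in> I \<Longrightarrow> 0 \<le> f i"
  shows "(\<Sum>\<^sub>\<infinity>i\<in>I. ennreal (f i)) = ennreal s"
proof -
  have "ennreal s = (SUP F\<in>{F. finite F \<and> F \<subseteq> I}. ennreal (sum f F))"
    using infsum_nonneg_is_SUPREMUM_ennreal[of f I] assms has_sum_imp_summable infsumI by metis
  also have "\<dots> = (SUP F\<in>{F. finite F \<and> F \<subseteq> I}. \<Sum>i\<in>F. ennreal (f i))"
    using assms(2) by (intro SUP_cong refl sum_ennreal[symmetric]) auto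
  finally show ?thesis by (simp add: nonneg_infsum_complete)
qed

section \<open>Bounds on the Wasserstein distance\<close>

lemma transport_cost_finite_support:
  assumes "finite S" "S \<subseteq> V" "finite T" "T \<subseteq> V"
    and "\<And>u v. u \<in> V \<Longrightarrow> v \<in> V \<Longrightarrow> \<not> (u \<in> S \<and> v \<in> T) \<Longrightarrow> \<pi> u v = 0"
  shows "transport_cost V E \<pi> =
    (\<Sum>u\<in>S. \<Sum>v\<in>T. ennreal_of_enat (graph_dist E u v) * ennreal (\<pi> u v))"
proof -
  have "transport_cost V E \<pi> =
      (\<Sum>\<^sub>\<infinity>v\<in>V. \<Sum>u\<in>S. ennreal_of_enat (graph_dist E u v) * ennreal (\<pi> u v))"
    unfolding transport_cost_def
    by (intro infsum_cong infsum_finite_support) (use assms in auto)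
  also have "\<dots> = (\<Sum>v\<in>T. \<Sum>u\<in>S. ennreal_of_enat (graph_dist E u v) * ennreal (\<pi> u v))"
    by (intro infsum_finite_support sum.neutral) (use assms in auto)
  finally show ?thesis by (simp add: sum.swap[of _ T S])
qed

text \<open>The witness is the deterministic plan that moves mass \<open>c\<close> from each
  \<open>u\<close> to \<open>\<tau> u\<close>.\<close>

lemma wasserstein1_le_bij:
  fixes c :: real
  assumes "finite S" "S \<subseteq> V" "T \<subseteq> V" and \<tau>: "bij_betw \<tau> S T" and c: "0 \<le> c" "c \<le> 1"
    and \<mu>: "\<And>u. u \<in> V \<Longrightarrow> \<mu> u = (if u \<in> S then c else 0)"
    and \<nu>: "\<And>v. v \<in> V \<Longrightarrow> \<nu> v = (if v \<in> T then c else 0)"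
    and dist: "\<And>u. u \<in> S \<Longrightarrow> graph_dist E u (\<tau> u) = enat (f u)"
  shows "wasserstein1 V E \<mu> \<nu> \<le> ennreal (c * real (\<Sum>u\<in>S. f u))"
proof -
  define \<pi> where "\<pi> u v = (if u \<in> S \<and> v = \<tau> u then c else 0)" for u v
  have finT: "finite T" using \<tau> assms(1) bij_betw_finite by blast
  have \<tau>T: "\<tau> u \<in> T" if "u \<in> S" for u using \<tau> that by (rule bij_betwE[THEN bspec])
  have plan: "transport_plan V \<mu> \<nu> \<pi>"
    unfolding transport_plan_def
  proof (intro conjI ballI)
    show "\<pi> u v \<in> {0..1}" for u v using c by (simp add: \<pi>_def)
    show "(\<pi> u has_sum \<mu> u) V" if "u \<in> V" for u
    proof (cases "u \<in> S")
      case True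
      have "\<pi> u = (\<lambda>v. if v = \<tau> u then c else 0)" using True by (simp add: \<pi>_def fun_eq_iff)
      moreover have "\<mu> u = c" using \<mu>[OF that] True by simp
      ultimately show ?thesis
        using has_sum_indicator[of "\<tau> u" V c] \<tau>T[OF True] assms(3) by auto
    next
      case False
      then have "\<pi> u = (\<lambda>v. 0)" by (simp add: \<pi>_def fun_eq_iff)
      then show ?thesis using False \<mu>[OF that] by simp
    qed
    show "((\<lambda>u. \<pi> u v) has_sum \<nu> v) V" if "v \<in> V" for v
    proof (cases "v \<in> T")
      case True
      then obtain u where u: "u \<in> S" "v = \<tau> u" using \<tau> by (auto simp: bij_betw_def)
      have "(\<lambda>w. \<pi> w v) = (\<lambda>w. if w = u then c else 0)"
        using u \<tau> by (auto simp: \<pi>_def fun_eq_iff bij_betw_def inj_on_def)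
      then show ?thesis
        using has_sum_indicator[of u V c] u assms(2) True \<nu>[OF that] by auto
    next
      case False
      then have "(\<lambda>w. \<pi> w v) = (\<lambda>w. 0)" using \<tau>T by (auto simp: \<pi>_def fun_eq_iff)
      then show ?thesis using False \<nu>[OF that] by simp
    qed
  qed
  have "transport_cost V E \<pi> =
      (\<Sum>u\<in>S. \<Sum>v\<in>T. ennreal_of_enat (graph_dist E u v) * ennreal (\<pi> u v))"
    by (rule transport_cost_finite_support) (use assms(1-3) finT \<tau>T in \<open>auto simp: \<pi>_def\<close>)
  also have "\<dots> = (\<Sum>u\<in>S. \<Sum>v\<in>T. if v = \<tau> u then ennreal (c * real (f u)) else 0)"
    by (intro sum.cong refl)
      (auto simp: \<pi>_def dist c ennreal_mult ennreal_of_nat_eq_real_of_nat mult.commute)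
  also have "\<dots> = (\<Sum>u\<in>S. ennreal (c * real (f u)))"
    by (intro sum.cong refl) (simp add: finT \<tau>T)
  also have "\<dots> = ennreal (c * real (\<Sum>u\<in>S. f u))"
    using c by (simp add: sum_distrib_left)
  finally show ?thesis
    unfolding wasserstein1_def using plan by (metis INF_lower mem_Collect_eq)
qed

text \<open>A plan \<pi> for \<mu> and \<nu> yields the plan \<open>t * \<pi> + \<rho>\<close> for
  the mixtures, where \<rho> carries the extra mass from \<open>u\<close> to \<open>v\<close>. The
  cost is additive, and the infimum over \<pi> gives the bound.\<close>

lemma wasserstein1_mix_dirac:
  fixes t :: real
  assumes "u \<in> V" "v \<in> V" and t: "0 < t" "t \<le> 1" and "graph_dist E u v \<noteq> \<infinity>"
  shows "wasserstein1 V E (\<lambda>z. t * \<mu> z + (if z = u then 1 - t else 0))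
      (\<lambda>z. t * \<nu> z + (if z = v then 1 - t else 0))
    \<le> ennreal t * wasserstein1 V E \<mu> \<nu> + ennreal (1 - t) * ennreal_of_enat (graph_dist E u v)"
    (is "?W \<le> _ + ?s")
proof -
  have key: "?W \<le> ennreal t * transport_cost V E \<pi> + ?s" if \<pi>: "transport_plan V \<mu> \<nu> \<pi>" for \<pi>
  proof -
    define \<rho> where "\<rho> a b = (if a = u \<and> b = v then 1 - t else 0)" for a b
    have \<pi>01: "0 \<le> \<pi> a b" "\<pi> a b \<le> 1" if "a \<in> V" "b \<in> V" for a b
      using \<pi> that by (auto simp: transport_plan_def)
    have plan: "transport_plan V (\<lambda>z. t * \<mu> z + (if z = u then 1 - t else 0))
      (\<lambda>z. t * \<nu> z + (if z = v then 1 - t else 0)) (\<lambda>a b. t * \<pi> a b + \<rho> a b)"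
      unfolding transport_plan_def
    proof (intro conjI ballI)
      fix a b assume ab: "a \<in> V" "b \<in> V"
      have "t * \<pi> a b \<le> t" "0 \<le> t * \<pi> a b" using t \<pi>01[OF ab] by (auto simp: mult_left_le)
      moreover have "0 \<le> \<rho> a b" "\<rho> a b \<le> 1 - t" using t by (auto simp: \<rho>_def)
      ultimately show "t * \<pi> a b + \<rho> a b \<in> {0..1}" by simp
    next
      fix a assume a: "a \<in> V"
      have "(\<rho> a has_sum (if a = u then 1 - t else 0)) V"
        using has_sum_indicator[OF assms(2), of "1 - t"] by (cases "a = u") (simp_all add: \<rho>_def[abs_def])
      then show "((\<lambda>b. t * \<pi> a b + \<rho> a b) has_sum t * \<mu> a + (if a = u then 1 - t else 0)) V"
        using \<pi> a by (intro has_sum_add has_sum_cmult_right) (auto simp: transport_plan_def)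
    next
      fix b assume b: "b \<in> V"
      have "((\<lambda>a. \<rho> a b) has_sum (if b = v then 1 - t else 0)) V"
        using has_sum_indicator[OF assms(1), of "1 - t"] by (cases "b = v") (simp_all add: \<rho>_def)
      then show "((\<lambda>a. t * \<pi> a b + \<rho> a b) has_sum t * \<nu> b + (if b = v then 1 - t else 0)) V"
        using \<pi> b by (intro has_sum_add has_sum_cmult_right) (auto simp: transport_plan_def)
    qed
    have "transport_cost V E (\<lambda>a b. t * \<pi> a b + \<rho> a b) =
      (\<Sum>\<^sub>\<infinity>b\<in>V. \<Sum>\<^sub>\<infinity>a\<in>V. ennreal t * (ennreal_of_enat (graph_dist E a b) * ennreal (\<pi> a b))
         + ennreal_of_enat (graph_dist E a b) * ennreal (\<rho> a b))"
      unfolding transport_cost_def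
      by (intro infsum_cong)
        (use t in \<open>simp add: \<pi>01 \<rho>_def ennreal_mult distrib_left mult.left_commute\<close>)
    also have "\<dots> = ennreal t * transport_cost V E \<pi> + transport_cost V E \<rho>"
      by (simp only: transport_cost_def infsum_add_ennreal infsum_cmult_right_ennreal)
    also have "transport_cost V E \<rho> = ?s"
      by (subst transport_cost_finite_support[of "{u}" V "{v}"])
        (use assms(1,2) in \<open>auto simp: \<rho>_def mult.commute\<close>)
    finally show ?thesis
      unfolding wasserstein1_def using plan by (metis (no_types, lifting) INF_lower mem_Collect_eq)
  qed
  \<comment> \<open>The bound for each \<pi> is solved for \<open>transport_cost V E \<pi>\<close>,
    so that the infimum can be taken there. This inverts the affine map because \<open>?s\<close> is
    finite and \<open>t\<close> is positive.\<close>
  have fin: "?s \<noteq> top" using assms(5) by (auto simp: ennreal_mult_eq_top_iff)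
  have "(?W - ?s) / ennreal t \<le> wasserstein1 V E \<mu> \<nu>"
    unfolding wasserstein1_def[of V E \<mu> \<nu>]
  proof (rule INF_greatest)
    fix \<pi> assume "\<pi> \<in> {\<pi>. transport_plan V \<mu> \<nu> \<pi>}"
    then have "?W - ?s \<le> ennreal t * transport_cost V E \<pi>"
      using key fin by (simp add: ennreal_minus_le_iff add.commute)
    then show "(?W - ?s) / ennreal t \<le> transport_cost V E \<pi>"
      using t by (subst divide_le_posI_ennreal) (auto simp: mult.commute)
  qed
  then have "ennreal t * ((?W - ?s) / ennreal t) \<le> ennreal t * wasserstein1 V E \<mu> \<nu>"
    by (rule mult_left_mono) simp
  then have "?W - ?s \<le> ennreal t * wasserstein1 V E \<mu> \<nu>"
    using ennreal_mult_divide_eq[of "ennreal t" "?W - ?s"] t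
    by (simp add: ennreal_times_divide mult.commute)
  then show ?thesis by (auto simp: ennreal_minus_le_iff add.commute)
qed

text \<open>Of the mass arriving at \<open>v\<close>, only \<open>\<pi> v v\<close>, which is at
  most \<open>\<mu> v\<close>, stays in place; the rest travels distance at least 1.\<close>

lemma wasserstein1_ge_mass:
  assumes "v \<in> V"
  shows "ennreal (\<nu> v - \<mu> v) \<le> wasserstein1 V E \<mu> \<nu>"
  unfolding wasserstein1_def
proof (rule INF_greatest)
  fix \<pi> assume "\<pi> \<in> {\<pi>. transport_plan V \<mu> \<nu> \<pi>}"
  then have \<pi>0: "\<And>a b. a \<in> V \<Longrightarrow> b \<in> V \<Longrightarrow> 0 \<le> \<pi> a b"
    and row: "(\<pi> v has_sum \<mu> v) V" and col: "((\<lambda>a. \<pi> a v) has_sum \<nu> v) V"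
    using assms by (auto simp: transport_plan_def)
  have "((\<lambda>b. if b = v then \<pi> v v else 0) has_sum \<pi> v v) V"
    by (rule has_sum_indicator[OF assms])
  from has_sum_mono[OF this row] have le: "\<pi> v v \<le> \<mu> v" using \<pi>0 assms by auto
  have off: "((\<lambda>a. \<pi> a v + - (if a = v then \<pi> v v else 0)) has_sum (\<nu> v + - \<pi> v v)) V"
    by (intro has_sum_add col has_sum_uminus[THEN iffD2]) (simp add: has_sum_indicator assms)
  have "ennreal (\<nu> v - \<mu> v) \<le> ennreal (\<nu> v + - \<pi> v v)"
    using le by (intro ennreal_leI) simp
  also have "\<dots> = (\<Sum>\<^sub>\<infinity>a\<in>V. ennreal (\<pi> a v + - (if a = v then \<pi> v v else 0)))"
    by (rule infsum_ennreal_has_sum[OF off, symmetric]) (use \<pi>0 assms in auto)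
  also have "\<dots> \<le> (\<Sum>\<^sub>\<infinity>a\<in>V. ennreal_of_enat (graph_dist E a v) * ennreal (\<pi> a v))"
  proof (rule infsum_mono)
    fix a assume "a \<in> V"
    show "ennreal (\<pi> a v + - (if a = v then \<pi> v v else 0))
        \<le> ennreal_of_enat (graph_dist E a v) * ennreal (\<pi> a v)"
    proof (cases "a = v")
      case False
      have "ennreal_of_enat 1 \<le> ennreal_of_enat (graph_dist E a v)"
        using graph_dist_ge_1[OF False] by (simp only: ennreal_of_enat_le_iff)
      then have "1 * ennreal (\<pi> a v) \<le> ennreal_of_enat (graph_dist E a v) * ennreal (\<pi> a v)"
        by (intro mult_right_mono) (simp_all only: ennreal_of_enat_1 zero_le)
      then show ?thesis using False by simp
    qed simp
  qed (simp_all add: nonneg_summable_on_complete)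
  also have "\<dots> \<le> transport_cost V E \<pi>"
    unfolding transport_cost_def by (rule infsum_ge_single_ennreal[OF assms])
  finally show "ennreal (\<nu> v - \<mu> v) \<le> transport_cost V E \<pi>" .
qed

section \<open>Varying the idleness and the limit at 1\<close>

text \<open>The factor \<open>t\<close> scales the moving mass \<open>1 - p\<close> to
  \<open>1 - q\<close>, and \<open>t * p + (1 - t) = q\<close> is left at \<open>x\<close>. This
  brings a change of idleness into the form of \<open>wasserstein1_mix_dirac\<close>.\<close>

lemma lazy_walk_measure_mix:
  assumes "p < 1" "(x, x) \<notin> E"
  shows "lazy_walk_measure E q x =
    (\<lambda>z. (1 - q) / (1 - p) * lazy_walk_measure E p x z
       + (if z = x then 1 - (1 - q) / (1 - p) else 0))"
proof -
  define t where "t = (1 - q) / (1 - p)"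
  have t: "t * (1 - p) = 1 - q" using assms(1) by (simp add: t_def)
  then have "t * p + (1 - t) = q" by (simp add: algebra_simps)
  then show ?thesis
    using assms(2) t by (auto simp: lazy_walk_measure_def fun_eq_iff simp flip: t_def)
qed

text \<open>The limit is the supremum over \<open>{a..<b}\<close>, which dominates the value at
  \<open>a\<close>.\<close>

lemma bounded_mono_tendsto_at_left:
  fixes g :: "real \<Rightarrow> real"
  assumes "a < b"
    and mono: "\<And>p q. a \<le> p \<Longrightarrow> p \<le> q \<Longrightarrow> q < b \<Longrightarrow> g p \<le> g q"
    and bound: "\<And>p. a \<le> p \<Longrightarrow> p < b \<Longrightarrow> g p \<le> C"
  shows "\<exists>L \<ge> g a. (g \<longlongrightarrow> L) (at_left b)"
proof -
  have bdd: "bdd_above (g ` {a..<b})" using bound by (intro bdd_aboveI[of _ C]) auto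
  define L where "L = Sup (g ` {a..<b})"
  have le: "g p \<le> L" if "a \<le> p" "p < b" for p
    unfolding L_def by (rule cSup_upper[OF _ bdd]) (use that in auto)
  have "(g \<longlongrightarrow> L) (at_left b)"
  proof (rule increasing_tendsto)
    show "\<forall>\<^sub>F p in at_left b. g p \<le> L"
      using eventually_at_left_real[OF assms(1)] by eventually_elim (use le in auto)
    fix l assume "l < L"
    then obtain p where p: "a \<le> p" "p < b" "l < g p"
      unfolding L_def using less_cSup_iff[OF _ bdd, of l] assms(1) by auto
    show "\<forall>\<^sub>F q in at_left b. l < g q"
      using eventually_at_left_real[OF p(2)]
    proof eventually_elim
      case (elim q)
      then show ?case using mono[of p q] p by auto
    qed
  qed
  then show ?thesis using le[of a] assms(1) by auto
qed

text \<open>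
  Mixing with the Dirac plan (\<open>wasserstein1_mix_dirac\<close>) makes the curvature quotient
  nondecreasing, and moving the mass into \<open>y\<close> costs at least its amount, which bounds the
  quotient by 2. Hence the limit exists and \<^const>\<open>Lim\<close> is not a junk value.
\<close>

lemma LLY_curvature_ge:
  assumes "simple_graph V E" "(x, y) \<in> E" "0 \<le> p0" "p0 < 1" "0 \<le> w"
    and w: "wasserstein1 V E (lazy_walk_measure E p0 x) (lazy_walk_measure E p0 y) \<le> ennreal w"
  shows "(1 - w) / (1 - p0) \<le> LLY_curvature V E x y"
proof -
  have xy: "x \<in> V" "y \<in> V" "x \<noteq> y" and irr: "(x, x) \<notin> E" "(y, y) \<notin> E"
    using assms(1,2) by (auto simp: simple_graph_def irrefl_def)
  have dist: "graph_dist E x y = 1" using graph_dist_adjacent assms(2) xy(3) by metis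
  define W where "W p = wasserstein1 V E (lazy_walk_measure E p x) (lazy_walk_measure E p y)" for p
  define g where "g p = p_curvature V E p x y / (1 - p)" for p
  have g: "g p = (1 - enn2real (W p)) / (1 - p)" for p
    by (simp add: g_def p_curvature_def W_def dist one_enat_def)
  have mix: "W q \<le> ennreal ((1 - q) / (1 - p)) * W p + ennreal (1 - (1 - q) / (1 - p))"
    if "p \<le> q" "q < 1" for p q
  proof -
    have "0 < (1 - q) / (1 - p)" "(1 - q) / (1 - p) \<le> 1" using that by (auto simp: divide_le_eq_1)
    from wasserstein1_mix_dirac[OF xy(1,2) this, of E "lazy_walk_measure E p x" "lazy_walk_measure E p y"]
    show ?thesis
      using that irr lazy_walk_measure_mix[of p _ E q]
      by (simp add: W_def dist flip: lazy_walk_measure_mix)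
  qed
  \<comment> \<open>Finiteness at \<open>p0\<close> comes from \<open>w\<close> and spreads through
    \<open>mix\<close>. It matters because \<open>enn2real\<close> sends \<open>top\<close> to
    0.\<close>
  have fin: "W p < top" if "p0 \<le> p" "p < 1" for p
  proof -
    have "W p0 < top" using w le_less_trans by (fastforce simp: W_def)
    then have "ennreal ((1 - p) / (1 - p0)) * W p0 + ennreal (1 - (1 - p) / (1 - p0)) < top"
      by (simp add: ennreal_mult_less_top)
    then show ?thesis using mix[OF that] by (rule le_less_trans[rotated])
  qed
  have mono: "g p \<le> g q" if "p0 \<le> p" "p \<le> q" "q < 1" for p q
  proof -
    define t where "t = (1 - q) / (1 - p)"
    have t: "0 < t" "t \<le> 1" using that by (auto simp: t_def divide_le_eq_1)
    have "W p < top" "W q < top" using that by (auto intro: fin)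
    then obtain r s where r: "W p = ennreal r" "0 \<le> r" and s: "W q = ennreal s" "0 \<le> s"
      by (cases "W p"; cases "W q") auto
    have "ennreal s \<le> ennreal (t * r + (1 - t))"
      using mix[OF that(2,3)] r s t by (simp add: ennreal_mult flip: t_def)
    then have "s \<le> t * r + (1 - t)" using r t by (subst (asm) ennreal_le_iff) auto
    \<comment> \<open>Dividing this by \<open>1 - q = t * (1 - p)\<close> compares the two
      quotients.\<close>
    then have "t * (1 - r) \<le> 1 - s" by (simp add: algebra_simps)
    then have "t * (1 - r) / (1 - q) \<le> (1 - s) / (1 - q)"
      using that by (intro divide_right_mono) auto
    moreover have "t * (1 - r) / (1 - q) = (1 - r) / (1 - p)" using that by (simp add: t_def)
    ultimately show ?thesis using r s by (simp add: g)
  qed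
  have bound: "g p \<le> 2" if "p0 \<le> p" "p < 1" for p
  proof -
    \<comment> \<open>The walk from \<open>y\<close> keeps mass \<open>p\<close> at
      \<open>y\<close>, so at least \<open>2 * p - 1\<close> must be moved there, and
      \<open>1 - (2 * p - 1)\<close> is twice \<open>1 - p\<close>.\<close>
    have "lazy_walk_measure E p x y \<le> 1 - p"
    \<comment> \<open>As \<open>y\<close> is a neighbour of \<open>x\<close>, cardinality 0 means an
      infinite neighbourhood; division by 0 then makes the mass 0.\<close>
    proof (cases "card (E `` {x}) = 0")
      case False
      then have "(1 - p) / real (card (E `` {x})) \<le> (1 - p) / 1"
        using that by (intro divide_left_mono) auto
      then show ?thesis using xy assms(2) by (simp add: lazy_walk_measure_def)
    qed (use xy assms(2) that in \<open>simp add: lazy_walk_measure_def\<close>)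
    then have "ennreal (2 * p - 1) \<le> W p"
      using wasserstein1_ge_mass[OF xy(2), of "lazy_walk_measure E p y" "lazy_walk_measure E p x" E]
      unfolding W_def by (elim order_trans[rotated]) (use xy(3) in \<open>auto intro!: ennreal_leI simp: lazy_walk_measure_def\<close>)
    then have "2 * p - 1 \<le> enn2real (W p)"
      using fin[OF that] by (cases "W p") (auto simp: ennreal_le_iff2)
    then show ?thesis using that by (simp add: g divide_le_eq)
  qed
  obtain L where L: "g p0 \<le> L" "(g \<longlongrightarrow> L) (at_left 1)"
    using bounded_mono_tendsto_at_left[of p0 1 g 2] assms(4) mono bound by blast
  have "LLY_curvature V E x y = L"
    unfolding LLY_curvature_def using tendsto_Lim[OF _ L(2)] by (simp add: g_def[abs_def])
  moreover have "(1 - w) / (1 - p0) \<le> g p0"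
    unfolding g W_def using w assms(4,5) by (intro divide_right_mono) (auto intro: enn2real_leI)
  ultimately show ?thesis using L(1) by simp
qed

section \<open>Local structure of amply regular graphs\<close>

text \<open>A walk between distinct non-adjacent vertices must leave the closed unit ball of its
  start \<open>u\<close>. The exit vertex \<open>z\<close> is at distance 2 from \<open>u\<close>,
  and its predecessor \<open>w\<close> is a common neighbour.\<close>

lemma amply_regular_beta_pos:
  assumes ar: "amply_regular V E n d \<alpha> \<beta>"
    and con: "connected_graph V E" and nc: "\<not> complete_graph V E"
  shows "\<beta> > 0"
proof -
  obtain u v where uv: "u \<in> V" "v \<in> V" "u \<noteq> v" "(u, v) \<notin> E"
    using nc by (auto simp: complete_graph_def)
  have "(u, v) \<in> E\<^sup>*" using con uv by (simp add: connected_graph_def)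
  then have "(v = u \<or> (u, v) \<in> E) \<or> (\<exists>w z. (u, w) \<in> E \<and> (w, z) \<in> E \<and> u \<noteq> z \<and> (u, z) \<notin> E)"
    by (induction rule: rtrancl_induct) auto
  then obtain w z where wz: "(u, w) \<in> E" "(w, z) \<in> E" "u \<noteq> z" "(u, z) \<notin> E"
    using uv by blast
  have E: "E \<subseteq> V \<times> V" "sym E" using ar by (auto simp: amply_regular_def simple_graph_def)
  have "card (E `` {u} \<inter> E `` {z}) = \<beta>"
    using ar graph_dist_common_neighbour[OF wz] wz E(1) uv(1) by (auto simp: amply_regular_def)
  moreover have "w \<in> E `` {u} \<inter> E `` {z}" using wz E(2) by (auto dest: symD)
  moreover have "finite (E `` {u})" using ar uv(1) by (simp add: amply_regular_def)
  ultimately show ?thesis by (metis card_gt_0_iff empty_iff finite_Int)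
qed

lemma amply_regular_row_sum:
  assumes ar: "amply_regular V E n d \<alpha> \<beta>" and "\<alpha> \<le> \<beta>"
    and xy: "(x, y) \<in> E" and a: "a \<in> E `` {x} - {y}"
  shows "(\<Sum>b\<in>E `` {y} - {x}. of_bool ((a, b) \<in> E) + (\<beta> - \<alpha>) * of_bool (a = b)) = \<beta> - 1"
proof -
  have E: "E \<subseteq> V \<times> V" "sym E" "irrefl E" using ar by (auto simp: amply_regular_def simple_graph_def)
  have V: "x \<in> V" "y \<in> V" "a \<in> V" using E(1) xy a by auto
  have fin: "finite (E `` {v})" if "v \<in> V" for v using ar that by (simp add: amply_regular_def)
  have ax: "a \<noteq> x" "(a, x) \<in> E" "(x, a) \<in> E" "(y, x) \<in> E" "a \<noteq> y"
    using a E xy by (auto simp: irrefl_def dest: symD)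
  let ?B = "E `` {y} - {x}"
  have finB: "finite ?B" using fin[OF V(2)] by simp
  have "(\<Sum>b\<in>?B. of_bool ((a, b) \<in> E)) = card (?B \<inter> E `` {a})"
    using finB by (simp add: of_bool_def sum.If_cases Image_singleton Int_def)
  also have "?B \<inter> E `` {a} = E `` {a} \<inter> E `` {y} - {x}" by auto
  \<comment> \<open>The vertex \<open>x\<close> is itself a common neighbour of \<open>a\<close> and
    \<open>y\<close>, hence the 1 subtracted.\<close>
  also have "card \<dots> = card (E `` {a} \<inter> E `` {y}) - 1"
    using ax by (intro card_Diff_singleton) auto
  finally have 1: "(\<Sum>b\<in>?B. of_bool ((a, b) \<in> E)) = card (E `` {a} \<inter> E `` {y}) - 1" .
  have 2: "(\<Sum>b\<in>?B. (\<beta> - \<alpha>) * of_bool (a = b)) = (if (a, y) \<in> E then \<beta> - \<alpha> else 0)"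
    using finB ax E(2) by (auto simp: of_bool_def if_distrib cong: if_cong dest: symD)
  show ?thesis
  proof (cases "(a, y) \<in> E")
    case True
    then have "card (E `` {a} \<inter> E `` {y}) = \<alpha>" using ar V by (simp add: amply_regular_def)
    \<comment> \<open>Ensures that \<alpha> is at least 1, so that the truncated \<alpha> - 1 and
      \<beta> - \<alpha> add up to \<beta> - 1.\<close>
    moreover have "card (E `` {a} \<inter> E `` {y}) > 0"
      using ax fin[OF V(3)] by (auto simp: card_gt_0_iff)
    ultimately show ?thesis using 1 2 True assms(2) by (simp add: sum.distrib)
  next
    case False
    then have "graph_dist E a y = 2"
      using graph_dist_common_neighbour[of a x E y] ax xy by blast
    then have "card (E `` {a} \<inter> E `` {y}) = \<beta>" using ar V by (simp add: amply_regular_def)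
    then show ?thesis using 1 2 False by (simp add: sum.distrib)
  qed
qed

text \<open>Each of the \<open>d - 1\<close> rows has weight \<beta> - 1. Loops, of total weight
  \<alpha> * (\<beta> - \<alpha>), cost 0 and edges cost 1, so total cost plus loop weight is the
  total weight. The additive form avoids both division and truncated subtraction of the loop
  weight.\<close>

lemma amply_regular_cheap_bijection:
  assumes ar: "amply_regular V E n d \<alpha> \<beta>" and "\<alpha> \<le> \<beta>" "2 \<le> \<beta>" and xy: "(x, y) \<in> E"
  shows "\<exists>\<sigma>. bij_betw \<sigma> (E `` {x} - {y}) (E `` {y} - {x}) \<and>
    (\<beta> - 1) * (\<Sum>a\<in>E `` {x} - {y}. the_enat (graph_dist E a (\<sigma> a))) + \<alpha> * (\<beta> - \<alpha>)
      \<le> (d - 1) * (\<beta> - 1)"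
proof -
  let ?A = "E `` {x} - {y}" and ?B = "E `` {y} - {x}"
  define m where "m a b = of_bool ((a, b) \<in> E) + (\<beta> - \<alpha>) * of_bool (a = b)" for a b
  define c where "c a b = the_enat (graph_dist E a b)" for a b
  have E: "E \<subseteq> V \<times> V" "sym E" "irrefl E" using ar by (auto simp: amply_regular_def simple_graph_def)
  have yx: "(y, x) \<in> E" using E(2) xy by (rule symD)
  have V: "x \<in> V" "y \<in> V" using E(1) xy by auto
  have fin: "finite (E `` {x})" "finite (E `` {y})" and cx: "card (E `` {x}) = d"
    using ar V by (auto simp: amply_regular_def)
  have finA: "finite ?A" and finB: "finite ?B" using fin by auto
  have cA: "card ?A = d - 1" using cx xy by (simp add: card_Diff_singleton)
  have cAB: "card (?A \<inter> ?B) = \<alpha>"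
  proof -
    have "?A \<inter> ?B = E `` {x} \<inter> E `` {y}" using E(3) by (auto simp: irrefl_def)
    then show ?thesis using ar V xy by (simp add: amply_regular_def)
  qed
  have row: "(\<Sum>b\<in>?B. m a b) = \<beta> - 1" if "a \<in> ?A" for a
    unfolding m_def by (rule amply_regular_row_sum[OF ar assms(2) xy that])
  \<comment> \<open>The multiplicities are symmetric, so this is the row sum with \<open>x\<close>
    and \<open>y\<close> exchanged.\<close>
  have col: "(\<Sum>a\<in>?A. m a b) = \<beta> - 1" if "b \<in> ?B" for b
  proof -
    have "m a b = of_bool ((b, a) \<in> E) + (\<beta> - \<alpha>) * of_bool (b = a)" for a
      using E(2) by (auto simp: m_def sym_def)
    then show ?thesis using amply_regular_row_sum[OF ar assms(2) yx that] by simp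
  qed
  obtain \<sigma> where \<sigma>: "bij_betw \<sigma> ?A ?B"
      "(\<beta> - 1) * (\<Sum>a\<in>?A. c a (\<sigma> a)) \<le> (\<Sum>a\<in>?A. \<Sum>b\<in>?B. m a b * c a b)"
    using regular_matrix_cheap_bijection[OF finA finB _ row col, of c] assms(3) by auto
  \<comment> \<open>Cost 0 removes the loops on the diagonal; off the diagonal only edges have
    weight, and they cost 1.\<close>
  have mc: "m a b * c a b = of_bool ((a, b) \<in> E)" for a b
  proof (cases "a = b")
    case True
    then show ?thesis using E(3) by (simp add: c_def irrefl_def zero_enat_def)
  next
    case False
    then show ?thesis by (simp add: m_def c_def graph_dist_adjacent one_enat_def)
  qed
  have "(\<Sum>a\<in>?A. \<Sum>b\<in>?B. (\<beta> - \<alpha>) * of_bool (a = b)) = (\<Sum>a\<in>?A. if a \<in> ?B then \<beta> - \<alpha> else 0)"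
    using finB by (intro sum.cong refl) (simp add: of_bool_def if_distrib cong: if_cong)
  also have "\<dots> = \<alpha> * (\<beta> - \<alpha>)"
    using finA cAB by (simp add: sum.If_cases Int_def)
  finally have loops: "(\<Sum>a\<in>?A. \<Sum>b\<in>?B. (\<beta> - \<alpha>) * of_bool (a = b)) = \<alpha> * (\<beta> - \<alpha>)" .
  have "(\<Sum>a\<in>?A. \<Sum>b\<in>?B. m a b * c a b) + \<alpha> * (\<beta> - \<alpha>) = (\<Sum>a\<in>?A. \<Sum>b\<in>?B. m a b)"
    unfolding loops[symmetric] mc by (simp add: m_def sum.distrib)
  also have "\<dots> = (d - 1) * (\<beta> - 1)" by (simp add: row cA)
  finally show ?thesis using \<sigma> unfolding c_def by (intro exI[of _ \<sigma>]) auto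
qed

section \<open>The curvature bound for an edge\<close>

theorem theorem3p1:
  fixes V :: "'a set" and E :: "'a rel" and n :: enat and d \<alpha> \<beta> :: nat
  assumes "amply_regular V E n d \<alpha> \<beta>"
    and "connected_graph V E"
    and "\<not> complete_graph V E"
    and "\<not> empty_graph E"
    and "\<beta> \<noteq> 1"
    and "\<beta> \<ge> \<alpha>"
    and "(x, y) \<in> E"
  shows "LLY_curvature V E x y
           \<ge> (2 + real_of_int \<lceil>real \<alpha> * (real \<beta> - real \<alpha>) / (real \<beta> - 1)\<rceil>) / real d"
proof -
  let ?A = "E `` {x} - {y}" and ?B = "E `` {y} - {x}"
  have \<beta>: "2 \<le> \<beta>" using amply_regular_beta_pos[OF assms(1-3)] assms(5) by simp
  obtain \<sigma> where \<sigma>: "bij_betw \<sigma> ?A ?B" and cost: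
      "(\<beta> - 1) * (\<Sum>a\<in>?A. the_enat (graph_dist E a (\<sigma> a))) + \<alpha> * (\<beta> - \<alpha>) \<le> (d - 1) * (\<beta> - 1)"
    using amply_regular_cheap_bijection[OF assms(1,6) \<beta> assms(7)] by blast
  define C where "C = (\<Sum>a\<in>?A. the_enat (graph_dist E a (\<sigma> a)))"
  have sg: "simple_graph V E" using assms(1) by (simp add: amply_regular_def)
  then have E: "E \<subseteq> V \<times> V" "sym E" "irrefl E" by (auto simp: simple_graph_def)
  have xy: "x \<in> V" "y \<in> V" "x \<noteq> y" "(y, x) \<in> E"
    using E assms(7) by (auto simp: irrefl_def dest: symD)
  have fin: "finite (E `` {x})" "finite (E `` {y})" and deg: "card (E `` {x}) = d" "card (E `` {y}) = d"
    using assms(1) xy by (auto simp: amply_regular_def)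
  have d: "d \<ge> 1" using deg(1) fin(1) assms(7) by (metis Image_singleton_iff One_nat_def Suc_leI card_gt_0_iff empty_iff)

  \<comment> \<open>These are the closed unit balls around \<open>x\<close> and \<open>y\<close>.
    Both contain \<open>x\<close> and \<open>y\<close>, which \<tau> fixes at no cost.\<close>
  let ?S = "insert x (insert y ?A)" and ?T = "insert x (insert y ?B)"
  define \<tau> where "\<tau> u = (if u \<in> ?A then \<sigma> u else u)" for u
  have \<tau>A: "bij_betw \<tau> ?A ?B"
    using \<sigma> by (rule bij_betw_cong[THEN iffD1, rotated]) (simp add: \<tau>_def)
  have \<tau>xy: "\<tau> x = x" "\<tau> y = y" using E(3) by (auto simp: \<tau>_def irrefl_def)
  have ST: "?S = ?A \<union> {x, y}" "?T = ?B \<union> {x, y}" by auto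
  have "bij_betw \<tau> {x, y} {x, y}" using xy(3) \<tau>xy by (auto simp: bij_betw_def inj_on_def)
  then have \<tau>: "bij_betw \<tau> ?S ?T"
    unfolding ST using E(3) by (intro bij_betw_combine[OF \<tau>A]) (auto simp: irrefl_def)

  \<comment> \<open>The solution of \<open>(1 - p0) / real d = p0\<close>: centre and neighbours get
    equal mass.\<close>
  define p0 where "p0 = 1 / (real d + 1)"
  have p0_compl: "1 - p0 = real d / (real d + 1)" by (simp add: p0_def field_simps)
  have p0: "0 \<le> p0" "p0 \<le> 1" "p0 < 1" "(1 - p0) / real d = p0"
    using d unfolding p0_compl by (auto simp: p0_def)
  have "wasserstein1 V E (lazy_walk_measure E p0 x) (lazy_walk_measure E p0 y)
      \<le> ennreal (p0 * real (\<Sum>u\<in>?S. the_enat (graph_dist E u (\<tau> u))))"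
  proof (rule wasserstein1_le_bij[OF _ _ _ \<tau> p0(1,2)])
    show "finite ?S" using fin by simp
    show SV: "?S \<subseteq> V" and TV: "?T \<subseteq> V" using xy E(1) by auto
    show "lazy_walk_measure E p0 x u = (if u \<in> ?S then p0 else 0)" for u
      using p0(4) deg assms(7) by (auto simp: lazy_walk_measure_def)
    show "lazy_walk_measure E p0 y u = (if u \<in> ?T then p0 else 0)" for u
      using p0(4) deg xy(4) by (auto simp: lazy_walk_measure_def)
    show "graph_dist E u (\<tau> u) = enat (the_enat (graph_dist E u (\<tau> u)))" if "u \<in> ?S" for u
      using graph_dist_finite[OF assms(2)] SV TV that bij_betwE[OF \<tau>] by blast
  qed
  also have "(\<Sum>u\<in>?S. the_enat (graph_dist E u (\<tau> u))) = (\<Sum>u\<in>?A. the_enat (graph_dist E u (\<tau> u)))"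
    by (rule sum.mono_neutral_right) (use fin \<tau>xy in \<open>auto simp: zero_enat_def\<close>)
  also have "\<dots> = C" unfolding C_def by (intro sum.cong refl) (simp add: \<tau>_def)
  finally have "(1 - p0 * real C) / (1 - p0) \<le> LLY_curvature V E x y"
    using p0 by (intro LLY_curvature_ge[OF sg assms(7)]) auto
  also have "(1 - p0 * real C) / (1 - p0) = (real d + 1 - real C) / real d"
  proof -
    have "1 - p0 * real C = (real d + 1 - real C) / (real d + 1)" by (simp add: p0_def field_simps)
    then show ?thesis unfolding p0_compl by simp
  qed
  finally have L: "(real d + 1 - real C) / real d \<le> LLY_curvature V E x y" .

  \<comment> \<open>From here the cost bound is moved to the reals; the natural subtractions are
    exact since \<beta> is at least 2 and at least \<alpha>, and \<open>d\<close> is at least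
    1.\<close>
  have "real ((\<beta> - 1) * C + \<alpha> * (\<beta> - \<alpha>)) \<le> real ((d - 1) * (\<beta> - 1))"
    using cost unfolding C_def by (rule of_nat_mono)
  moreover have "real (\<beta> - 1) = real \<beta> - 1" "real (d - 1) = real d - 1"
      "real (\<beta> - \<alpha>) = real \<beta> - real \<alpha>"
    using \<beta> d assms(6) by (simp_all add: of_nat_diff)
  ultimately have "real \<alpha> * (real \<beta> - real \<alpha>) \<le> (real d - 1 - real C) * (real \<beta> - 1)"
    by (simp only: of_nat_add of_nat_mult) (simp only: algebra_simps)
  then have "real \<alpha> * (real \<beta> - real \<alpha>) / (real \<beta> - 1) \<le> real d - 1 - real C"
    using \<beta> by (simp add: divide_le_eq)
  \<comment> \<open>The upper bound is an integer, so it also bounds the ceiling.\<close>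
  also have "\<dots> = real_of_int (int d - 1 - int C)" by simp
  finally have "\<lceil>real \<alpha> * (real \<beta> - real \<alpha>) / (real \<beta> - 1)\<rceil> \<le> int d - 1 - int C"
    by (simp only: ceiling_le_iff)
  then have "2 + real_of_int \<lceil>real \<alpha> * (real \<beta> - real \<alpha>) / (real \<beta> - 1)\<rceil> \<le> real d + 1 - real C"
    by linarith
  then show ?thesis using L d by (meson divide_right_mono of_nat_0_le_iff order_trans)
qed

end
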